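(* Let the outcome be binary ($J=2$), suppose $r_1\le\cdots\le r_N$ and $\delta_1\le\delta_2\le\cdots\le\delta_I$, and let $\gamma\ge0$. Then the exact, worst-case null distribution of the cell counts $(N_{12},\dots,N_{I2})$, i.e. their distribution under the worst-case unmeasured confounder for sign-score tests $\mathbf{u}^+=(0,\dots,0,1,\dots,1)$ ($N_{\cdot1}$ zeros followed by $N_{\cdot2}$ ones), is the multivariate extended hypergeometric distribution with margins $\mathbf{N}_{I\cdot}=(N_{1\cdot},\dots,N_{I\cdot})$, $N_{\cdot2}$, and (log-)weights $\gamma\boldsymbol\delta=(\gamma\delta_1,\dots,\gamma\delta_I)$; that is, for all $(t_1,\dots,t_I)\in\mathbb{Z}_{\ge0}^I$ with $\sum_it_i=N_{\cdot2}$, $$\mathbb{P}_{\mathbf{u}^+}(N_{12}=t_1,\dots,N_{I2}=t_I)=\frac{\prod_{i=1}^I\binom{N_{i\cdot}}{t_i}\exp(\gamma\delta_it_i)}{\sum_{\mathbf{q}\in\mathbb{Z}_{\ge0}^I,\ q_1+\cdots+q_I=N_{\cdot2}}\ \prod_{i=1}^I\binom{N_{i\cdot}}{q_i}\exp(\gamma\delta_iq_i)}.$$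
   Context: Fix integers $N$, $I\ge 2$ and positive integers $N_{1\cdot},\dots,N_{I\cdot}$ with $\sum_i N_{i\cdot}=N$. Let $\mathcal{Z}(\mathbf{N}_{I\cdot})=\{\mathbf{z}\in\{1,\dots,I\}^N:\ |\{s:z_s=i\}|=N_{i\cdot}\ \forall i\}$. The outcome vector $\mathbf{r}\in\{1,2\}^N$ is fixed (sharp null hypothesis), and $N_{\cdot j}=|\{s:r_s=j\}|$. Let $\boldsymbol\delta\in\{0,1\}^I$ (not all entries equal). For $\mathbf{u}\in[0,1]^N$, under $\mathbb{P}_{\mathbf{u}}$ the random treatment vector $\mathbf{Z}$ takes values in $\mathcal{Z}(\mathbf{N}_{I\cdot})$ with $$\mathbb{P}_{\mathbf{u}}(\mathbf{Z}=\mathbf{z})=\frac{\exp\{\gamma\sum_{s=1}^N\delta_{z_s}u_s\}}{\sum_{\mathbf{b}\in\mathcal{Z}(\mathbf{N}_{I\cdot})}\exp\{\gamma\sum_{s=1}^N\delta_{b_s}u_s\}}.$$ The cell counts are $N_{ij}=\sum_{s=1}^N\mathbb{1}\{Z_s=i,r_s=j\}$. A sign-score test statistic is $\sum_iw_iN_{i2}$ with $w_1\le\cdots\le w_I$; the worst-case unmeasured confounder maximizes its upper tail probability over $\mathbf{u}\in[0,1]^N$, and the vector $\mathbf{u}^+$ given in the claim is one. Binomial coefficients $\binom{n}{k}$ with $k>n$ are $0$. *)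

theory Defs
  imports "HOL-Probability.Probability_Mass_Function"
begin

definition normalized_pmf :: "'a set \<Rightarrow> ('a \<Rightarrow> real) \<Rightarrow> 'a pmf" where
  "normalized_pmf A f = embed_pmf (\<lambda>x. if x \<in> A then f x / (\<Sum>y\<in>A. f y) else 0)"

lemma pmf_normalized_pmf:
  assumes fin: "finite A" and nonneg: "\<And>x. x \<in> A \<Longrightarrow> f x \<ge> 0" and pos: "(\<Sum>y\<in>A. f y) > 0"
  shows "pmf (normalized_pmf A f) x = (if x \<in> A then f x / (\<Sum>y\<in>A. f y) else 0)"
  unfolding normalized_pmf_def
proof (rule pmf_embed_pmf)
  let ?g = "\<lambda>x. if x \<in> A then f x / (\<Sum>y\<in>A. f y) else 0"
  show "0 \<le> ?g x" for x
    using nonneg pos by auto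
  have "(\<integral>\<^sup>+x. ennreal (?g x) \<partial>count_space UNIV) = (\<Sum>x\<in>A. ennreal (?g x))"
    using fin by (subst nn_integral_count_space'[of A]) auto
  also have "\<dots> = ennreal (\<Sum>x\<in>A. ?g x)"
    by (rule sum_ennreal) (use nonneg pos in auto)
  also have "(\<Sum>x\<in>A. ?g x) = 1"
    using pos by (simp flip: sum_divide_distrib)
  finally show "(\<integral>\<^sup>+x. ennreal (?g x) \<partial>count_space UNIV) = 1"
    by simp
qed

text \<open>
  Vectors indexed by \<open>{1..n}\<close> are functions on \<^typ>\<open>nat\<close>. Treatment assignments and vectors of
  cell counts are extensional, i.e. \<^const>\<open>undefined\<close> off their index set, so that each
  vector is represented by exactly one function.
\<close>

definition assignments :: "nat \<Rightarrow> nat \<Rightarrow> (nat \<Rightarrow> nat) \<Rightarrow> (nat \<Rightarrow> nat) set" where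
  "assignments N I m =
     {z \<in> {1..N} \<rightarrow>\<^sub>E {1..I}. \<forall>i\<in>{1..I}. card {s \<in> {1..N}. z s = i} = m i}"

definition treatment_weight ::
    "nat \<Rightarrow> real \<Rightarrow> (nat \<Rightarrow> real) \<Rightarrow> (nat \<Rightarrow> real) \<Rightarrow> (nat \<Rightarrow> nat) \<Rightarrow> real" where
  "treatment_weight N \<gamma> \<delta> u z = exp (\<gamma> * (\<Sum>s=1..N. \<delta> (z s) * u s))"

definition treatment_pmf ::
    "nat \<Rightarrow> nat \<Rightarrow> (nat \<Rightarrow> nat) \<Rightarrow> real \<Rightarrow> (nat \<Rightarrow> real) \<Rightarrow> (nat \<Rightarrow> real) \<Rightarrow> (nat \<Rightarrow> nat) pmf" where
  "treatment_pmf N I m \<gamma> \<delta> u = normalized_pmf (assignments N I m) (treatment_weight N \<gamma> \<delta> u)"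

definition outcome_total :: "nat \<Rightarrow> (nat \<Rightarrow> nat) \<Rightarrow> nat \<Rightarrow> nat" where
  "outcome_total N r j = card {s \<in> {1..N}. r s = j}"

definition cell_count :: "nat \<Rightarrow> (nat \<Rightarrow> nat) \<Rightarrow> (nat \<Rightarrow> nat) \<Rightarrow> nat \<Rightarrow> nat \<Rightarrow> nat" where
  "cell_count N r z i j = card {s \<in> {1..N}. z s = i \<and> r s = j}"

definition u_plus :: "nat \<Rightarrow> (nat \<Rightarrow> nat) \<Rightarrow> nat \<Rightarrow> real" where
  "u_plus N r s = (if s \<le> outcome_total N r 1 then 0 else 1)"

definition count_vectors :: "nat \<Rightarrow> nat \<Rightarrow> (nat \<Rightarrow> nat) set" where
  "count_vectors I n = {q \<in> {1..I} \<rightarrow>\<^sub>E UNIV. (\<Sum>i=1..I. q i) = n}"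

definition ext_hypergeom_weight ::
    "nat \<Rightarrow> (nat \<Rightarrow> nat) \<Rightarrow> (nat \<Rightarrow> real) \<Rightarrow> (nat \<Rightarrow> nat) \<Rightarrow> real" where
  "ext_hypergeom_weight I m \<theta> q = (\<Prod>i=1..I. real (m i choose q i) * exp (\<theta> i * real (q i)))"

text \<open>The weights \<open>\<theta>\<close> are on the log scale.\<close>

definition mv_ext_hypergeom_pmf ::
    "nat \<Rightarrow> (nat \<Rightarrow> nat) \<Rightarrow> nat \<Rightarrow> (nat \<Rightarrow> real) \<Rightarrow> (nat \<Rightarrow> nat) pmf" where
  "mv_ext_hypergeom_pmf I m n \<theta> =
     normalized_pmf (count_vectors I n) (ext_hypergeom_weight I m \<theta>)"

text \<open>The normalizing sums are positive, so both distributions have the intended mass functions.\<close>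

lemma finite_assignments: "finite (assignments N I m)"
  unfolding assignments_def by (rule finite_subset[of _ "{1..N} \<rightarrow>\<^sub>E {1..I}"]) (auto intro: finite_PiE)

lemma finite_count_vectors: "finite (count_vectors I n)"
proof (rule finite_subset)
  show "count_vectors I n \<subseteq> {1..I} \<rightarrow>\<^sub>E {..n}"
  proof
    fix q assume q: "q \<in> count_vectors I n"
    have "q i \<le> n" if "i \<in> {1..I}" for i
    proof -
      have "q i \<le> (\<Sum>i=1..I. q i)"
        using that by (intro member_le_sum) auto
      thus ?thesis
        using q by (simp add: count_vectors_def)
    qed
    thus "q \<in> {1..I} \<rightarrow>\<^sub>E {..n}"
      using q by (auto simp: count_vectors_def PiE_iff)
  qed
qed (auto intro: finite_PiE)

lemma assignments_nonempty:
  assumes "(\<Sum>i=1..I. m i) = N"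
  shows "assignments N I m \<noteq> {}"
proof -
  have "\<exists>z \<in> {1..N} \<rightarrow> {1..I}. \<forall>i\<in>{1..I}. card {s \<in> {1..N}. z s = i} = m i"
    using assms
  proof (induction I arbitrary: N)
    case 0
    thus ?case by auto
  next
    case (Suc I)
    let ?M = "\<Sum>i=1..I. m i"
    have N: "N = ?M + m (Suc I)"
      using Suc.prems by simp
    obtain z where z: "z \<in> {1..?M} \<rightarrow> {1..I}"
        "\<And>i. i \<in> {1..I} \<Longrightarrow> card {s \<in> {1..?M}. z s = i} = m i"
      using Suc.IH[OF refl] by blast
    define z' where "z' s = (if s \<le> ?M then z s else Suc I)" for s
    have zI: "z s \<in> {1..I}" if "s \<in> {1..?M}" for s
      using z(1) that by auto
    have "z' \<in> {1..N} \<rightarrow> {1..Suc I}"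
      using zI by (force simp: z'_def)
    moreover have "card {s \<in> {1..N}. z' s = i} = m i" if "i \<in> {1..Suc I}" for i
    proof (cases "i = Suc I")
      case True
      have "{s \<in> {1..N}. z' s = i} = {?M + 1..?M + m (Suc I)}"
        using zI True by (force simp: z'_def N)
      thus ?thesis
        using True by simp
    next
      case False
      have "{s \<in> {1..N}. z' s = i} = {s \<in> {1..?M}. z s = i}"
        using False by (auto simp: z'_def N split: if_splits)
      thus ?thesis
        using z(2)[of i] that False by auto
    qed
    ultimately show ?case by blast
  qed
  then obtain z where z: "z \<in> {1..N} \<rightarrow> {1..I}"
      "\<And>i. i \<in> {1..I} \<Longrightarrow> card {s \<in> {1..N}. z s = i} = m i"
    by blast
  have "restrict z {1..N} \<in> {1..N} \<rightarrow>\<^sub>E {1..I}"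
    using z(1) by (simp add: restrict_PiE_iff Pi_iff)
  moreover have "{s \<in> {1..N}. restrict z {1..N} s = i} = {s \<in> {1..N}. z s = i}" for i
    by auto
  ultimately have "restrict z {1..N} \<in> assignments N I m"
    using z(2) by (simp add: assignments_def)
  thus ?thesis by blast
qed

lemma pmf_treatment_pmf:
  assumes "(\<Sum>i=1..I. m i) = N"
  shows "pmf (treatment_pmf N I m \<gamma> \<delta> u) z =
    (if z \<in> assignments N I m then
       exp (\<gamma> * (\<Sum>s=1..N. \<delta> (z s) * u s)) /
       (\<Sum>b\<in>assignments N I m. exp (\<gamma> * (\<Sum>s=1..N. \<delta> (b s) * u s)))
     else 0)"
proof -
  have "(\<Sum>b\<in>assignments N I m. treatment_weight N \<gamma> \<delta> u b) > 0"
    using assignments_nonempty[OF assms] finite_assignments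
    by (intro sum_pos) (auto simp: treatment_weight_def)
  thus ?thesis
    unfolding treatment_pmf_def
    by (subst pmf_normalized_pmf) (auto simp: finite_assignments treatment_weight_def)
qed

lemma count_vector_below:
  assumes "n \<le> (\<Sum>i=1..I. m i)"
  shows "\<exists>q\<in>count_vectors I n. \<forall>i\<in>{1..I}. q i \<le> m i"
proof -
  have "\<exists>q. (\<Sum>i=1..I. q i) = n \<and> (\<forall>i\<in>{1..I}. q i \<le> m i)"
    using assms
  proof (induction I arbitrary: n)
    case 0
    thus ?case by simp
  next
    case (Suc I)
    let ?k = "min n (m (Suc I))"
    have "n - ?k \<le> (\<Sum>i=1..I. m i)"
      using Suc.prems by simp
    then obtain q where q: "(\<Sum>i=1..I. q i) = n - ?k" "\<forall>i\<in>{1..I}. q i \<le> m i"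
      using Suc.IH by blast
    have "(\<Sum>i=1..I. (q(Suc I := ?k)) i) = (\<Sum>i=1..I. q i)"
      by (intro sum.cong) auto
    hence "(\<Sum>i=1..Suc I. (q(Suc I := ?k)) i) = n"
      using q(1) by simp
    moreover have "\<forall>i\<in>{1..Suc I}. (q(Suc I := ?k)) i \<le> m i"
      using q(2) by (auto simp: le_Suc_eq)
    ultimately show ?case by blast
  qed
  then obtain q where q: "(\<Sum>i=1..I. q i) = n" "\<forall>i\<in>{1..I}. q i \<le> m i"
    by blast
  have "restrict q {1..I} \<in> count_vectors I n"
    using q(1) by (simp add: count_vectors_def)
  thus ?thesis
    using q(2) by (intro bexI[of _ "restrict q {1..I}"]) auto
qed

lemma pmf_mv_ext_hypergeom_pmf:
  assumes "n \<le> (\<Sum>i=1..I. m i)"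
  shows "pmf (mv_ext_hypergeom_pmf I m n \<theta>) t =
    (if t \<in> count_vectors I n then
       (\<Prod>i=1..I. real (m i choose t i) * exp (\<theta> i * real (t i))) /
       (\<Sum>q\<in>count_vectors I n. \<Prod>i=1..I. real (m i choose q i) * exp (\<theta> i * real (q i)))
     else 0)"
proof -
  have nonneg: "ext_hypergeom_weight I m \<theta> q \<ge> 0" for q
    by (auto simp: ext_hypergeom_weight_def intro!: prod_nonneg)
  obtain q where q: "q \<in> count_vectors I n" "\<forall>i\<in>{1..I}. q i \<le> m i"
    using count_vector_below[OF assms] by blast
  have "ext_hypergeom_weight I m \<theta> q > 0"
    unfolding ext_hypergeom_weight_def using q(2) by (intro prod_pos) auto
  hence "(\<Sum>q\<in>count_vectors I n. ext_hypergeom_weight I m \<theta> q) > 0"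
    using nonneg q(1) finite_count_vectors by (intro sum_pos2[of _ q]) auto
  thus ?thesis
    unfolding mv_ext_hypergeom_pmf_def
    by (subst pmf_normalized_pmf)
       (simp_all add: finite_count_vectors nonneg, simp add: ext_hypergeom_weight_def)
qed

end

theory Submission
  imports Defs
begin

text \<open>
  Because \<^term>\<open>r\<close> is increasing, \<open>u\<^sup>+\<close> is the indicator of \<open>r = 2\<close>, so the weight of an
  assignment is \<open>exp (\<gamma> \<Sum>\<^sub>i \<delta>\<^sub>i t\<^sub>i)\<close> and depends only on its cell counts \<open>t\<close>. The assignments with
  cell counts \<open>t\<close> split into a product of two multinomial counts, one for each outcome, giving
  \<open>(N\<^sub>1! / \<Prod>\<^sub>i (m\<^sub>i - t\<^sub>i)!) (N\<^sub>2! / \<Prod>\<^sub>i t\<^sub>i!)\<close> of them. This is \<open>\<Prod>\<^sub>i (m\<^sub>i choose t\<^sub>i)\<close> up to the factor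
  \<open>N\<^sub>1! N\<^sub>2! / \<Prod>\<^sub>i m\<^sub>i!\<close>, which is independent of \<open>t\<close> and cancels on normalization.
\<close>

section \<open>Counting functions with prescribed fibre sizes\<close>

text \<open>Arbitrary domain and codomain replace the intervals of \<open>assignments\<close>, so
  that values can be removed one at a time and the subjects can be split by outcome.\<close>

definition fibre_funs :: "'a set \<Rightarrow> 'b set \<Rightarrow> ('b \<Rightarrow> nat) \<Rightarrow> ('a \<Rightarrow> 'b) set" where
  "fibre_funs A J t = {z \<in> A \<rightarrow>\<^sub>E J. \<forall>i\<in>J. card {s \<in> A. z s = i} = t i}"

lemma finite_fibre_funs:
  assumes "finite A" "finite J"
  shows "finite (fibre_funs A J t)"
  by (rule finite_subset[of _ "A \<rightarrow>\<^sub>E J"]) (use assms in \<open>auto simp: fibre_funs_def intro: finite_PiE\<close>)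

lemma restrict_in_fibre_funs_iff:
  "restrict z A \<in> fibre_funs A J t \<longleftrightarrow> z \<in> A \<rightarrow> J \<and> (\<forall>i\<in>J. card {s \<in> A. z s = i} = t i)"
proof -
  have "{s \<in> A. restrict z A s = i} = {s \<in> A. z s = i}" for i
    by auto
  thus ?thesis
    by (simp only: fibre_funs_def mem_Collect_eq restrict_PiE_iff Pi_iff)
qed

text \<open>A function into \<open>insert k J\<close> is determined by its fibre \<open>B\<close>
  over \<open>k\<close> and its restriction to \<open>A - B\<close>, which takes values in
  \<open>J\<close>. This is the recursion behind the multinomial coefficient.\<close>

lemma bij_betw_fibre_funs_insert:
  assumes "k \<notin> J"
  shows "bij_betw (\<lambda>(B, z). \<lambda>s\<in>A. if s \<in> B then k else z s)
    (SIGMA B:{B. B \<subseteq> A \<and> card B = t k}. fibre_funs (A - B) J t)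
    (fibre_funs A (insert k J) t)"
proof (rule bij_betw_byWitness[where
      f' = "\<lambda>z. ({s \<in> A. z s = k}, restrict z (A - {s \<in> A. z s = k}))"])
  let ?S = "SIGMA B:{B. B \<subseteq> A \<and> card B = t k}. fibre_funs (A - B) J t"
  let ?f = "\<lambda>(B, z). \<lambda>s\<in>A. if s \<in> B then k else z s"
  let ?g = "\<lambda>z. ({s \<in> A. z s = k}, restrict z (A - {s \<in> A. z s = k}))"
  show "\<forall>p\<in>?S. ?g (?f p) = p"
  proof
    fix p assume "p \<in> ?S"
    then obtain B z where p: "p = (B, z)" and B: "B \<subseteq> A" and z: "z \<in> fibre_funs (A - B) J t"
      by auto
    have zJ: "z s \<in> J" if "s \<in> A - B" for s
      using z that by (auto simp: fibre_funs_def)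
    \<comment> \<open>Outside \<open>B\<close> the values lie in \<open>J\<close>, and
      \<open>k\<close> does not, so the fibre over \<open>k\<close> is exactly
      \<open>B\<close>.\<close>
    have 1: "{s \<in> A. ?f (B, z) s = k} = B"
      using B zJ assms by force
    have "restrict (?f (B, z)) (A - B) = z"
      using z by (auto simp: fibre_funs_def fun_eq_iff PiE_iff extensional_def)
    with 1 show "?g (?f p) = p"
      by (simp only: p)
  qed
  show "\<forall>z\<in>fibre_funs A (insert k J) t. ?f (?g z) = z"
    by (auto simp: fibre_funs_def fun_eq_iff PiE_iff extensional_def)
  show "?f ` ?S \<subseteq> fibre_funs A (insert k J) t"
  proof (rule image_subsetI)
    fix p assume "p \<in> ?S"
    then obtain B z where p: "p = (B, z)" and B: "B \<subseteq> A" "card B = t k"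
        and z: "z \<in> fibre_funs (A - B) J t"
      by auto
    have zJ: "z s \<in> J" if "s \<in> A - B" for s
      using z that by (auto simp: fibre_funs_def)
    have "{s \<in> A. ?f (B, z) s = k} = B"
      using B zJ assms by force
    moreover have "{s \<in> A. ?f (B, z) s = i} = {s \<in> A - B. z s = i}" if "i \<in> J" for i
      using that assms by auto
    moreover have "?f (B, z) \<in> A \<rightarrow>\<^sub>E insert k J"
      using zJ by auto
    ultimately have "?f (B, z) \<in> fibre_funs A (insert k J) t"
      using z B by (simp add: fibre_funs_def)
    thus "?f p \<in> fibre_funs A (insert k J) t"
      by (simp only: p)
  qed
  show "?g ` fibre_funs A (insert k J) t \<subseteq> ?S"
  proof (rule image_subsetI)
    fix z assume z: "z \<in> fibre_funs A (insert k J) t"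
    let ?B = "{s \<in> A. z s = k}"
    have "{s \<in> A - ?B. z s = i} = {s \<in> A. z s = i}" if "i \<in> J" for i
      using that assms by auto
    moreover have "z \<in> A - ?B \<rightarrow> J"
      using z by (auto simp: fibre_funs_def)
    ultimately have "restrict z (A - ?B) \<in> fibre_funs (A - ?B) J t"
      using z by (simp only: restrict_in_fibre_funs_iff) (simp add: fibre_funs_def)
    moreover have "card ?B = t k"
      using z by (simp add: fibre_funs_def)
    ultimately show "?g z \<in> ?S"
      by blast
  qed
qed

text \<open>The multinomial coefficient, with the denominator multiplied out to stay within the
  natural numbers. The induction on \<open>J\<close> keeps \<open>A\<close> arbitrary because the
  domain shrinks to \<open>A - B\<close>.\<close>

lemma card_fibre_funs:
  assumes "finite J" "finite A" "sum t J = card A"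
  shows "card (fibre_funs A J t) * (\<Prod>i\<in>J. fact (t i)) = fact (card A)"
  using assms
proof (induction J arbitrary: A rule: finite_induct)
  case empty
  thus ?case by (simp add: fibre_funs_def)
next
  case (insert k J)
  let ?Bs = "{B. B \<subseteq> A \<and> card B = t k}"
  have le: "t k \<le> card A"
    using insert by simp
  have "card (fibre_funs A (insert k J) t) = card (SIGMA B:?Bs. fibre_funs (A - B) J t)"
    using bij_betw_same_card[OF bij_betw_fibre_funs_insert[OF insert.hyps(2)]] by metis
  also have "\<dots> = (\<Sum>B\<in>?Bs. card (fibre_funs (A - B) J t))"
    using insert by (intro card_SigmaI) (auto intro: finite_fibre_funs)
  finally have "card (fibre_funs A (insert k J) t) * (\<Prod>i\<in>J. fact (t i))
      = (\<Sum>B\<in>?Bs. card (fibre_funs (A - B) J t) * (\<Prod>i\<in>J. fact (t i)))"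
    by (simp add: sum_distrib_right)
  \<comment> \<open>All remainders \<open>A - B\<close> have the same size, so the summand no longer
    depends on \<open>B\<close> and only the number of choices of \<open>B\<close> matters.\<close>
  also have "\<dots> = (\<Sum>B\<in>?Bs. fact (card A - t k))"
  proof (rule sum.cong[OF refl])
    fix B assume B: "B \<in> ?Bs"
    have "finite B"
      using B insert.prems by (auto intro: finite_subset)
    hence "card (A - B) = card A - t k"
      using B by (simp add: card_Diff_subset)
    thus "card (fibre_funs (A - B) J t) * (\<Prod>i\<in>J. fact (t i)) = fact (card A - t k)"
      using insert.IH[of "A - B"] insert.prems insert.hyps by simp
  qed
  also have "\<dots> = (card A choose t k) * fact (card A - t k)"
    using insert.prems by (simp add: n_subsets)
  finally have "card (fibre_funs A (insert k J) t) * (\<Prod>i\<in>insert k J. fact (t i))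
      = fact (t k) * fact (card A - t k) * (card A choose t k)"
    using insert.hyps by (simp add: algebra_simps)
  thus ?case
    using binomial_fact_lemma[OF le] by simp
qed

section \<open>Splitting the domain into two blocks\<close>

text \<open>Fibre sizes \<open>m\<close> overall and \<open>t\<close> on \<open>B\<close> force
  \<open>m i - t i\<close> on \<open>A\<close>, and the two restrictions are otherwise independent.
  The bound \<open>le\<close> makes the truncated subtraction exact, so that gluing recovers
  \<open>m i\<close>.\<close>

lemma bij_betw_fibre_funs_Un:
  assumes disj: "A \<inter> B = {}" and fin: "finite A" "finite B"
    and le: "\<And>i. i \<in> J \<Longrightarrow> t i \<le> m i"
  shows "bij_betw (\<lambda>z. (restrict z A, restrict z B))
    {z \<in> fibre_funs (A \<union> B) J m. \<forall>i\<in>J. card {s \<in> B. z s = i} = t i}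
    (fibre_funs A J (\<lambda>i. m i - t i) \<times> fibre_funs B J t)"
proof (rule bij_betw_byWitness[where f' = "\<lambda>(x, y). \<lambda>s\<in>A \<union> B. if s \<in> A then x s else y s"])
  let ?S = "{z \<in> fibre_funs (A \<union> B) J m. \<forall>i\<in>J. card {s \<in> B. z s = i} = t i}"
  let ?T = "fibre_funs A J (\<lambda>i. m i - t i) \<times> fibre_funs B J t"
  let ?f = "\<lambda>z. (restrict z A, restrict z B)"
  let ?g = "\<lambda>(x, y). \<lambda>s\<in>A \<union> B. if s \<in> A then x s else y s"
  have card_Un: "card {s \<in> A \<union> B. z s = i} = card {s \<in> A. z s = i} + card {s \<in> B. z s = i}"
    for z :: "'a \<Rightarrow> 'b" and i
  proof -
    have "{s \<in> A \<union> B. z s = i} = {s \<in> A. z s = i} \<union> {s \<in> B. z s = i}"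
      by auto
    thus ?thesis
      using disj fin by (simp, intro card_Un_disjoint) auto
  qed
  show "\<forall>z\<in>?S. ?g (?f z) = z"
    by (auto simp: fibre_funs_def fun_eq_iff PiE_iff extensional_def)
  show "\<forall>p\<in>?T. ?f (?g p) = p"
    using disj by (auto simp: fibre_funs_def fun_eq_iff PiE_iff extensional_def)
  show "?f ` ?S \<subseteq> ?T"
  proof clarify
    fix z assume z: "z \<in> fibre_funs (A \<union> B) J m" "\<forall>i\<in>J. card {s \<in> B. z s = i} = t i"
    have "card {s \<in> A. z s = i} = m i - t i" if "i \<in> J" for i
      using z that card_Un[of z i] by (simp add: fibre_funs_def)
    moreover have "z \<in> A \<rightarrow> J" "z \<in> B \<rightarrow> J"
      using z by (auto simp: fibre_funs_def)
    ultimately show "restrict z A \<in> fibre_funs A J (\<lambda>i. m i - t i) \<and> restrict z B \<in> fibre_funs B J t"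
      using z(2) by (simp add: restrict_in_fibre_funs_iff)
  qed
  show "?g ` ?T \<subseteq> ?S"
  proof (rule image_subsetI)
    fix p assume "p \<in> ?T"
    then obtain x y where p: "p = (x, y)" and x: "x \<in> fibre_funs A J (\<lambda>i. m i - t i)"
        and y: "y \<in> fibre_funs B J t"
      by auto
    have "{s \<in> A. ?g (x, y) s = i} = {s \<in> A. x s = i}" for i
      by auto
    moreover have "{s \<in> B. ?g (x, y) s = i} = {s \<in> B. y s = i}" for i
      using disj by auto
    moreover have "?g (x, y) \<in> A \<union> B \<rightarrow>\<^sub>E J"
      using x y by (auto simp: fibre_funs_def)
    ultimately have "?g (x, y) \<in> ?S"
      using x y le card_Un[of "?g (x, y)"] by (simp add: fibre_funs_def)
    thus "?g p \<in> ?S"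
      by (simp only: p)
  qed
qed

text \<open>The product of the two multinomial counts becomes a product of binomials through
  \<open>fact (m i) = fact (t i) * fact (m i - t i) * (m i choose t i)\<close>. No bound on
  \<open>t\<close> is assumed: if some \<open>t i\<close> exceeds \<open>m i\<close>, both sides
  vanish.\<close>

lemma card_fibre_funs_Un:
  assumes disj: "A \<inter> B = {}" and fin: "finite A" "finite B" "finite J"
    and m: "sum m J = card A + card B" and t: "sum t J = card B"
  shows "card {z \<in> fibre_funs (A \<union> B) J m. \<forall>i\<in>J. card {s \<in> B. z s = i} = t i}
      * (\<Prod>i\<in>J. fact (m i)) = fact (card A) * fact (card B) * (\<Prod>i\<in>J. m i choose t i)"
proof (cases "\<forall>i\<in>J. t i \<le> m i")
  case True
  let ?S = "{z \<in> fibre_funs (A \<union> B) J m. \<forall>i\<in>J. card {s \<in> B. z s = i} = t i}"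
  have S: "card ?S = card (fibre_funs A J (\<lambda>i. m i - t i)) * card (fibre_funs B J t)"
    using bij_betw_same_card[OF bij_betw_fibre_funs_Un[OF disj fin(1,2), of J t m]] True
    by (simp add: card_cartesian_product)
  have m_fact: "(\<Prod>i\<in>J. fact (m i))
      = (\<Prod>i\<in>J. fact (t i)) * (\<Prod>i\<in>J. fact (m i - t i)) * (\<Prod>i\<in>J. m i choose t i)"
    using True binomial_fact_lemma by (simp flip: prod.distrib)
  have "(\<Sum>i\<in>J. m i - t i) = card A"
    using True m t by (simp add: sum_subtractf_nat)
  hence A: "card (fibre_funs A J (\<lambda>i. m i - t i)) * (\<Prod>i\<in>J. fact (m i - t i)) = fact (card A)"
    using fin by (intro card_fibre_funs)
  have B: "card (fibre_funs B J t) * (\<Prod>i\<in>J. fact (t i)) = fact (card B)"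
    using fin t by (intro card_fibre_funs)
  show ?thesis
    \<comment> \<open>Both sides are now the same five factors in different orders.\<close>
    unfolding S m_fact A[symmetric] B[symmetric] by (simp only: mult_ac)
next
  case False
  then obtain i where i: "i \<in> J" "m i < t i"
    by force
  \<comment> \<open>The fibre over \<open>i\<close> within \<open>B\<close> has at most
    \<open>m i\<close> elements, fewer than \<open>t i\<close>.\<close>
  have "card {s \<in> B. z s = i} \<noteq> t i" if "z \<in> fibre_funs (A \<union> B) J m" for z
  proof -
    have "card {s \<in> B. z s = i} \<le> card {s \<in> A \<union> B. z s = i}"
      using fin by (intro card_mono) auto
    also have "\<dots> = m i"
      using that i by (simp add: fibre_funs_def)
    finally show ?thesis
      using i by simp
  qed
  hence "{z \<in> fibre_funs (A \<union> B) J m. \<forall>i\<in>J. card {s \<in> B. z s = i} = t i} = {}"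
    using i by blast
  moreover have "(\<Prod>i\<in>J. m i choose t i) = 0"
    using i fin by (auto simp: prod_zero_iff)
  ultimately show ?thesis
    by (simp only: card.empty mult_zero_left mult_zero_right)
qed

section \<open>Push-forward of a normalized weight\<close>

text \<open>If the weight of each fibre is proportional to \<open>g\<close> with one common constant
  \<open>c\<close>, then the total weight carries the same factor and \<open>c\<close>
  cancels.\<close>

lemma map_normalized_pmf:
  assumes fin: "finite A" "finite B" and img: "\<phi> ` A \<subseteq> B"
    and f: "\<And>x. x \<in> A \<Longrightarrow> f x \<ge> 0" and g: "\<And>y. y \<in> B \<Longrightarrow> g y \<ge> 0"
    and pos: "sum g B > 0" "c > 0"
    and fibre: "\<And>y. y \<in> B \<Longrightarrow> (\<Sum>x | x \<in> A \<and> \<phi> x = y. f x) = c * g y"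
  shows "map_pmf \<phi> (normalized_pmf A f) = normalized_pmf B g"
proof (rule pmf_eqI)
  fix y
  have total: "sum f A = c * sum g B"
    using sum.group[OF fin img, of f] fibre by (simp add: sum_distrib_left)
  hence pos': "sum f A > 0"
    using pos by simp
  have pmf: "pmf (normalized_pmf A f) x = (if x \<in> A then f x / sum f A else 0)" for x
    using fin f pos' by (intro pmf_normalized_pmf)
  \<comment> \<open>The preimage of \<open>y\<close> may contain points outside \<open>A\<close>,
    but these have mass zero.\<close>
  have "pmf (map_pmf \<phi> (normalized_pmf A f)) y
      = measure (normalized_pmf A f) {x \<in> A. \<phi> x = y}"
    unfolding pmf_map
    by (rule measure_pmf.finite_measure_eq_AE)
       (auto simp: AE_measure_pmf_iff set_pmf_eq pmf split: if_splits)
  also have "\<dots> = (\<Sum>x | x \<in> A \<and> \<phi> x = y. f x) / sum f A"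
    using fin by (simp add: measure_measure_pmf_finite pmf sum_divide_distrib)
  also have "\<dots> = pmf (normalized_pmf B g) y"
  proof (cases "y \<in> B")
    case True
    thus ?thesis
      using pmf_normalized_pmf[OF fin(2) g pos(1), of y] pos by (simp add: fibre total)
  next
    case False
    hence "{x. x \<in> A \<and> \<phi> x = y} = {}"
      using img by auto
    thus ?thesis
      using pmf_normalized_pmf[OF fin(2) g pos(1), of y] False by (simp only: sum.empty) simp
  qed
  finally show "pmf (map_pmf \<phi> (normalized_pmf A f)) y = pmf (normalized_pmf B g) y" .
qed

section \<open>Weights and counts of assignments in terms of the cell counts\<close>

text \<open>Monotonicity makes the subjects with outcome 1 an initial segment, so the threshold
  \<open>outcome_total N r 1\<close> in \<open>u_plus\<close> separates the two outcomes.\<close>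

lemma u_plus_eq_indicator:
  assumes r: "\<And>s. s \<in> {1..N} \<Longrightarrow> r s \<in> {1, 2}" and mono: "mono_on {1..N} r" and s: "s \<in> {1..N}"
  shows "u_plus N r s = (if r s = 2 then 1 else 0)"
proof -
  let ?S = "{s \<in> {1..N}. r s = 1}"
  have "s \<le> card ?S" if "r s = 1"
  proof -
    have "r s' = 1" if "s' \<in> {1..s}" for s'
      using mono_onD[OF mono, of s' s] r[of s'] s that \<open>r s = 1\<close> by auto
    hence "card {1..s} \<le> card ?S"
      using s by (intro card_mono) auto
    thus ?thesis by simp
  qed
  moreover have "card ?S < s" if "r s = 2"
  proof -
    \<comment> \<open>Every index with outcome 1 precedes \<open>s\<close>, so there are at most
      \<open>s - 1\<close> of them; this gives the strict inequality.\<close>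
    have "s' < s" if "s' \<in> ?S" for s'
      using mono_onD[OF mono, of s s'] s that \<open>r s = 2\<close> by (cases "s' < s") auto
    hence "card ?S \<le> card {1..<s}"
      by (intro card_mono) auto
    thus ?thesis
      using s by auto
  qed
  ultimately show ?thesis
    using r[OF s] by (auto simp: u_plus_def outcome_total_def)
qed

text \<open>Only subjects with outcome 2 contribute to the exponent; grouping them by treatment
  turns the sum over subjects into one over cells.\<close>

lemma treatment_weight_u_plus:
  assumes r: "\<And>s. s \<in> {1..N} \<Longrightarrow> r s \<in> {1, 2}" and mono: "mono_on {1..N} r"
    and z: "z \<in> {1..N} \<rightarrow> {1..I}"
  shows "treatment_weight N \<gamma> \<delta> (u_plus N r) z
    = exp (\<gamma> * (\<Sum>i=1..I. \<delta> i * real (cell_count N r z i 2)))"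
proof -
  let ?R = "{s \<in> {1..N}. r s = 2}"
  have "(\<Sum>s=1..N. \<delta> (z s) * u_plus N r s) = (\<Sum>s\<in>?R. \<delta> (z s))"
    using u_plus_eq_indicator[OF r mono]
    by (subst sum.inter_filter) (auto intro!: sum.cong)
  also have "\<dots> = (\<Sum>i=1..I. \<Sum>s | s \<in> ?R \<and> z s = i. \<delta> (z s))"
    using z by (intro sum.group[symmetric]) auto
  also have "\<dots> = (\<Sum>i=1..I. \<delta> i * real (cell_count N r z i 2))"
  proof (rule sum.cong[OF refl])
    fix i
    have "{s. s \<in> ?R \<and> z s = i} = {s \<in> {1..N}. z s = i \<and> r s = 2}"
      by auto
    thus "(\<Sum>s | s \<in> ?R \<and> z s = i. \<delta> (z s)) = \<delta> i * real (cell_count N r z i 2)"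
      by (simp add: cell_count_def mult.commute)
  qed
  finally show ?thesis
    by (simp add: treatment_weight_def)
qed

lemma sum_cell_count:
  assumes "z \<in> {1..N} \<rightarrow> {1..I}"
  shows "(\<Sum>i=1..I. cell_count N r z i j) = outcome_total N r j"
proof -
  let ?R = "{s \<in> {1..N}. r s = j}"
  have "outcome_total N r j = (\<Sum>i=1..I. \<Sum>s | s \<in> ?R \<and> z s = i. 1)"
    unfolding outcome_total_def card_eq_sum
    using assms by (intro sum.group[symmetric]) auto
  also have "\<dots> = (\<Sum>i=1..I. cell_count N r z i j)"
    by (intro sum.cong refl) (auto simp: cell_count_def intro!: arg_cong[of _ _ card])
  finally show ?thesis by simp
qed

text \<open>The two outcome classes partition \<open>{1..N}\<close>, so the two-block count applies
  with outcome 2 as the block \<open>B\<close>.\<close>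

lemma card_assignments_cell_count:
  assumes m: "(\<Sum>i=1..I. m i) = N" and r: "\<And>s. s \<in> {1..N} \<Longrightarrow> r s \<in> {1, 2}"
    and t: "(\<Sum>i=1..I. t i) = outcome_total N r 2"
  shows "card {z \<in> assignments N I m. \<forall>i\<in>{1..I}. cell_count N r z i 2 = t i}
      * (\<Prod>i=1..I. fact (m i))
    = fact (outcome_total N r 1) * fact (outcome_total N r 2) * (\<Prod>i=1..I. m i choose t i)"
proof -
  let ?A = "{s \<in> {1..N}. r s = 1}" and ?B = "{s \<in> {1..N}. r s = 2}"
  have "r s = 1 \<or> r s = 2" if "s \<in> {1..N}" for s
    using r[OF that] by simp
  hence un: "?A \<union> ?B = {1..N}"
    by blast
  have disj: "?A \<inter> ?B = {}"
    by auto
  have "card ?A + card ?B = N"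
    using card_Un_disjoint[of ?A ?B] un disj by simp
  hence "card {z \<in> fibre_funs (?A \<union> ?B) {1..I} m. \<forall>i\<in>{1..I}. card {s \<in> ?B. z s = i} = t i}
      * (\<Prod>i=1..I. fact (m i)) = fact (card ?A) * fact (card ?B) * (\<Prod>i=1..I. m i choose t i)"
    using m t disj by (intro card_fibre_funs_Un) (auto simp: outcome_total_def)
  moreover have "{s \<in> ?B. z s = i} = {s \<in> {1..N}. z s = i \<and> r s = 2}" for z :: "nat \<Rightarrow> nat" and i
    by auto
  ultimately show ?thesis
    unfolding un by (simp add: assignments_def fibre_funs_def cell_count_def outcome_total_def)
qed

section \<open>The law of the cell counts\<close>

lemma map_cell_count_treatment_pmf:
  assumes m: "(\<Sum>i=1..I. m i) = N" and r: "\<And>s. s \<in> {1..N} \<Longrightarrow> r s \<in> {1, 2}"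
    and mono: "mono_on {1..N} r"
  shows "map_pmf (\<lambda>z. \<lambda>i\<in>{1..I}. cell_count N r z i 2) (treatment_pmf N I m \<gamma> \<delta> (u_plus N r))
    = mv_ext_hypergeom_pmf I m (outcome_total N r 2) (\<lambda>i. \<gamma> * \<delta> i)"
  unfolding treatment_pmf_def mv_ext_hypergeom_pmf_def
proof (rule map_normalized_pmf)
  let ?n = "outcome_total N r" and ?\<phi> = "\<lambda>z. \<lambda>i\<in>{1..I}. cell_count N r z i 2"
  \<comment> \<open>The ratio between the number of assignments with cell counts \<open>t\<close>
    and the product of binomials; it is free of \<open>t\<close>.\<close>
  let ?c = "fact (?n 1) * fact (?n 2) / (\<Prod>i=1..I. fact (m i)) :: real"
  let ?w = "ext_hypergeom_weight I m (\<lambda>i. \<gamma> * \<delta> i)"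
  show "finite (assignments N I m)" "finite (count_vectors I (?n 2))"
    by (rule finite_assignments finite_count_vectors)+
  show "?\<phi> ` assignments N I m \<subseteq> count_vectors I (?n 2)"
    using sum_cell_count by (auto simp: count_vectors_def assignments_def PiE_def)
  show "0 \<le> treatment_weight N \<gamma> \<delta> (u_plus N r) z" for z
    by (simp add: treatment_weight_def)
  show nonneg: "0 \<le> ?w q" for q
    by (auto simp: ext_hypergeom_weight_def intro!: prod_nonneg)
  \<comment> \<open>Positivity of the normalizing sum needs one count vector lying below
    \<open>m\<close>, which exists since the outcome total is at most \<open>N\<close>.\<close>
  have "?n 2 \<le> card {1..N}"
    unfolding outcome_total_def by (intro card_mono) auto
  then obtain q where q: "q \<in> count_vectors I (?n 2)" "\<forall>i\<in>{1..I}. q i \<le> m i"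
    using count_vector_below[of "?n 2" m I] m by auto
  hence "?w q > 0"
    by (auto simp: ext_hypergeom_weight_def intro!: prod_pos)
  thus "sum ?w (count_vectors I (?n 2)) > 0"
    using q(1) nonneg finite_count_vectors by (intro sum_pos2[of _ q]) auto
  show "?c > 0"
    by (auto intro!: divide_pos_pos prod_pos)
  fix t assume t: "t \<in> count_vectors I (?n 2)"
  let ?Z = "{z \<in> assignments N I m. \<forall>i\<in>{1..I}. cell_count N r z i 2 = t i}"
  \<comment> \<open>Both vectors are \<open>undefined\<close> off \<open>{1..I}\<close>, so equality
    of functions is agreement on \<open>{1..I}\<close>.\<close>
  have "{z. z \<in> assignments N I m \<and> ?\<phi> z = t} = ?Z"
    using t by (auto simp: count_vectors_def fun_eq_iff PiE_iff extensional_def)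
  hence "(\<Sum>z | z \<in> assignments N I m \<and> ?\<phi> z = t. treatment_weight N \<gamma> \<delta> (u_plus N r) z)
      = (\<Sum>z\<in>?Z. exp (\<gamma> * (\<Sum>i=1..I. \<delta> i * real (t i))))"
  proof (rule sum.cong)
    fix z assume z: "z \<in> ?Z"
    hence "z \<in> {1..N} \<rightarrow> {1..I}"
      by (auto simp: assignments_def)
    from treatment_weight_u_plus[OF r mono this]
    show "treatment_weight N \<gamma> \<delta> (u_plus N r) z = exp (\<gamma> * (\<Sum>i=1..I. \<delta> i * real (t i)))"
      using z by simp
  qed
  also have "\<dots> = real (card ?Z) * (\<Prod>i=1..I. exp (\<gamma> * \<delta> i * real (t i)))"
    by (simp add: sum_distrib_left exp_sum mult.assoc)
  also have "real (card ?Z) = ?c * (\<Prod>i=1..I. real (m i choose t i))"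
  proof -
    have "(\<Sum>i=1..I. t i) = ?n 2"
      using t by (simp add: count_vectors_def)
    from card_assignments_cell_count[where I = I and t = t, OF m r this]
    have "real (card ?Z * (\<Prod>i=1..I. fact (m i)))
        = real (fact (?n 1) * fact (?n 2) * (\<Prod>i=1..I. m i choose t i))"
      by (simp only:)
    hence "real (card ?Z) * (\<Prod>i=1..I. fact (m i))
        = fact (?n 1) * fact (?n 2) * (\<Prod>i=1..I. real (m i choose t i))"
      by (simp only: of_nat_mult of_nat_prod of_nat_fact)
    moreover have "(\<Prod>i=1..I. fact (m i) :: real) \<noteq> 0"
      by simp
    ultimately show ?thesis
      by (simp add: field_simps)
  qed
  finally show "(\<Sum>z | z \<in> assignments N I m \<and> ?\<phi> z = t. treatment_weight N \<gamma> \<delta> (u_plus N r) z)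
      = ?c * ?w t"
    by (simp only: ext_hypergeom_weight_def prod.distrib mult.assoc)
qed

theorem corollary1:
  fixes N I :: nat and m :: "nat \<Rightarrow> nat" and r :: "nat \<Rightarrow> nat"
    and \<delta> :: "nat \<Rightarrow> real" and \<gamma> :: real
  assumes "I \<ge> 2"
    and "\<And>i. i \<in> {1..I} \<Longrightarrow> m i > 0"
    and "(\<Sum>i=1..I. m i) = N"
    and "\<And>s. s \<in> {1..N} \<Longrightarrow> r s \<in> {1, 2}"
    and "mono_on {1..N} r"
    and "\<And>i. i \<in> {1..I} \<Longrightarrow> \<delta> i \<in> {0, 1}"
    and "\<exists>i\<in>{1..I}. \<exists>j\<in>{1..I}. \<delta> i \<noteq> \<delta> j"
    and "mono_on {1..I} \<delta>"
    and "\<gamma> \<ge> 0"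
  shows
    "map_pmf (\<lambda>z. \<lambda>i\<in>{1..I}. cell_count N r z i 2) (treatment_pmf N I m \<gamma> \<delta> (u_plus N r))
       = mv_ext_hypergeom_pmf I m (outcome_total N r 2) (\<lambda>i. \<gamma> * \<delta> i)
     \<and> (\<forall>t :: nat \<Rightarrow> nat. (\<Sum>i=1..I. t i) = outcome_total N r 2 \<longrightarrow>
          measure_pmf.prob (treatment_pmf N I m \<gamma> \<delta> (u_plus N r))
              {z. \<forall>i\<in>{1..I}. cell_count N r z i 2 = t i}
            = (\<Prod>i=1..I. real (m i choose t i) * exp (\<gamma> * \<delta> i * real (t i)))
              / (\<Sum>q \<in> {q \<in> {1..I} \<rightarrow>\<^sub>E UNIV. (\<Sum>i=1..I. q i) = outcome_total N r 2}.
                   \<Prod>i=1..I. real (m i choose q i) * exp (\<gamma> * \<delta> i * real (q i))))"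
proof (intro conjI allI impI)
  let ?n = "outcome_total N r 2" and ?\<phi> = "\<lambda>z. \<lambda>i\<in>{1..I}. cell_count N r z i 2"
  let ?p = "treatment_pmf N I m \<gamma> \<delta> (u_plus N r)"
  show map: "map_pmf ?\<phi> ?p = mv_ext_hypergeom_pmf I m ?n (\<lambda>i. \<gamma> * \<delta> i)"
    by (rule map_cell_count_treatment_pmf) (use assms in auto)
  fix t :: "nat \<Rightarrow> nat" assume t: "(\<Sum>i=1..I. t i) = ?n"
  \<comment> \<open>Here \<open>t\<close> is arbitrary off \<open>{1..I}\<close>; its restriction is
    the representative in \<open>count_vectors\<close>, at which the mass function is
    evaluated.\<close>
  let ?t = "restrict t {1..I}"
  have "?n \<le> card {1..N}"
    unfolding outcome_total_def by (intro card_mono) auto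
  hence le: "?n \<le> (\<Sum>i=1..I. m i)"
    using assms(3) by simp
  have "?\<phi> z = ?t \<longleftrightarrow> (\<forall>i\<in>{1..I}. cell_count N r z i 2 = t i)" for z
    unfolding restrict_def fun_eq_iff by meson
  hence "{z. \<forall>i\<in>{1..I}. cell_count N r z i 2 = t i} = ?\<phi> -` {?t}"
    by blast
  hence "measure_pmf.prob ?p {z. \<forall>i\<in>{1..I}. cell_count N r z i 2 = t i}
      = pmf (mv_ext_hypergeom_pmf I m ?n (\<lambda>i. \<gamma> * \<delta> i)) ?t"
    by (simp add: pmf_map flip: map)
  also have "\<dots> = (\<Prod>i=1..I. real (m i choose t i) * exp (\<gamma> * \<delta> i * real (t i)))
      / (\<Sum>q\<in>count_vectors I ?n. \<Prod>i=1..I. real (m i choose q i) * exp (\<gamma> * \<delta> i * real (q i)))"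
    using t by (subst pmf_mv_ext_hypergeom_pmf[OF le]) (simp add: count_vectors_def)
  finally show "measure_pmf.prob ?p {z. \<forall>i\<in>{1..I}. cell_count N r z i 2 = t i}
      = (\<Prod>i=1..I. real (m i choose t i) * exp (\<gamma> * \<delta> i * real (t i)))
        / (\<Sum>q \<in> {q \<in> {1..I} \<rightarrow>\<^sub>E UNIV. (\<Sum>i=1..I. q i) = ?n}.
             \<Prod>i=1..I. real (m i choose q i) * exp (\<gamma> * \<delta> i * real (q i)))"
    by (simp only: count_vectors_def)
qed

end
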